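(* For any signed graph $\Gamma=(G,\sigma)$ with potential $\kappa=0$, we have $\lambda_1(\Delta_1^\sigma)=h_1^\sigma$. Moreover, if $\Gamma$ is balanced (and has at least two vertices), then $\lambda_2(\Delta_1^\sigma)=h_2^\sigma$.
   Context: Setting. $G=(V,E)$ is a finite simple undirected graph, $n=|V|$, with edge measure $w:E\to(0,\infty)$, vertex weight $\mu:V\to(0,\infty)$ and signature $\sigma:E\to\{-1,1\}$ (potential $\kappa=0$); values are written $w_{xy},\sigma_{xy},\mu_x$, and $x\sim y$ means $\{x,y\}\in E$. $\Gamma=(G,\sigma)$ is balanced if there is $\tau:V\to\{-1,1\}$ with $\tau(x)\sigma_{xy}\tau(y)=1$ for all $\{x,y\}\in E$. Variational eigenvalues of the signed $1$-Laplacian. $\mathcal S_1=\{f\in\mathbb R^V:\sum_x\mu_x|f(x)|=1\}$. For a compact set $S=-S$ its index (Krasnoselskii genus) $\gamma(S)$ is $0$ if $S=\emptyset$, otherwise the least positive integer $k$ for which an odd continuous map $S\to\mathbb R^k\setminus\{0\}$ exists ($\infty$ if none). $\mathcal F_k(\mathcal S_1)$ is the family of compact $A=-A\subset\mathcal S_1$ with $\gamma(A)\ge k$. With $\mathcal R_1^\sigma(f)=\frac{\sum_{\{x,y\}\in E}w_{xy}|f(x)-\sigma_{xy}f(y)|}{\sum_{x\in V}\mu_x|f(x)|}$, set $\lambda_k(\Delta_1^\sigma)=\inf_{S\in\mathcal F_k(\mathcal S_1)}\sup_{f\in S}\mathcal R_1^\sigma(f)$, $k=1,\dots,n$. Signed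 Cheeger constants. For $V_1,V_2\subset V$: $|E^{\pm}(V_1,V_2)|=\sum_{x\in V_1}\sum_{y\in V_2,\,y\sim x,\,\sigma_{xy}=\pm1}w_{xy}$, $|E^\pm(V_1)|=|E^\pm(V_1,V_1)|$, $|\partial V_1|=\sum_{x\in V_1}\sum_{y\notin V_1,\,y\sim x}w_{xy}$, $\mathrm{vol}_\mu(V_1)=\sum_{x\in V_1}\mu_x$. For disjoint $V_1,V_2$ with nonempty union, $\beta^\sigma(V_1,V_2)=\frac{2|E^+(V_1,V_2)|+|E^-(V_1)|+|E^-(V_2)|+|\partial(V_1\cup V_2)|}{\mathrm{vol}_\mu(V_1\cup V_2)}$. Then $h_k^\sigma=\min\max_{i=1,\dots,k}\beta^\sigma(V_{2i-1},V_{2i})$, the minimum over all families $\{(V_{2i-1},V_{2i})\}_{i=1}^k$ with $V_{2i-1}\cap V_{2i}=\emptyset$, $V_{2i-1}\cup V_{2i}\neq\emptyset$, and $(V_{2i-1}\cup V_{2i})\cap(V_{2j-1}\cup V_{2j})=\emptyset$ for $i\ne j$ ($1\le k\le n$). *)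

theory Defs
  imports "HOL-Analysis.Analysis" "HOL-Library.Extended_Nat"
begin

text \<open>
  The vertex set is the finite type \<open>'v\<close> (so \<open>n = CARD('v)\<close>), and \<open>\<real>\<^sup>V\<close> is \<open>real ^ 'v\<close>.
  Edges are two-element vertex sets; the values of \<open>w\<close> and \<open>\<sigma>\<close> outside \<open>E\<close> are never used.
\<close>

locale signed_graph =
  fixes E :: "'v::finite set set"
    and w :: "'v set \<Rightarrow> real"
    and \<mu> :: "'v \<Rightarrow> real"
    and \<sigma> :: "'v set \<Rightarrow> real"
  assumes edges: "e \<in> E \<Longrightarrow> card e = 2"
    and edge_measure_pos: "e \<in> E \<Longrightarrow> w e > 0"
    and vertex_weight_pos: "\<mu> x > 0"
    and signature: "e \<in> E \<Longrightarrow> \<sigma> e \<in> {-1, 1}"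

definition balanced :: "'v set set \<Rightarrow> ('v set \<Rightarrow> real) \<Rightarrow> bool" where
  "balanced E \<sigma> \<longleftrightarrow>
     (\<exists>\<tau> :: 'v \<Rightarrow> real. (\<forall>x. \<tau> x \<in> {-1, 1}) \<and>
        (\<forall>x y. {x, y} \<in> E \<longrightarrow> \<tau> x * \<sigma> {x, y} * \<tau> y = 1))"


section \<open>Krasnoselskii genus\<close>

text \<open>
  Since \<open>k\<close> is not fixed by a type, \<open>\<real>\<^sup>k\<close> is the library space \<^const>\<open>Euclidean_space\<close> \<open>k\<close> of sequences
  vanishing from index \<open>k\<close> on. The infimum of the empty set in \<^typ>\<open>enat\<close> is \<open>\<infinity>\<close>.
\<close>

definition odd_map_to :: "nat \<Rightarrow> 'a::real_normed_vector set \<Rightarrow> ('a \<Rightarrow> nat \<Rightarrow> real) \<Rightarrow> bool" where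
  "odd_map_to k S g \<longleftrightarrow>
     continuous_map (top_of_set S) (subtopology (Euclidean_space k) (- {\<lambda>i. 0})) g \<and>
     (\<forall>x\<in>S. g (- x) = (\<lambda>i. - g x i))"

definition genus :: "'a::real_normed_vector set \<Rightarrow> enat" where
  "genus S = (if S = {} then 0 else (INF k\<in>{k. k \<ge> 1 \<and> (\<exists>g. odd_map_to k S g)}. enat k))"


section \<open>Variational eigenvalues of the signed 1-Laplacian\<close>

definition unit_sphere1 :: "('v::finite \<Rightarrow> real) \<Rightarrow> (real ^ 'v) set" where
  "unit_sphere1 \<mu> = {f. (\<Sum>x\<in>UNIV. \<mu> x * \<bar>f $ x\<bar>) = 1}"

definition genus_family :: "('v::finite \<Rightarrow> real) \<Rightarrow> nat \<Rightarrow> (real ^ 'v) set set" where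
  "genus_family \<mu> k =
     {A. compact A \<and> A = uminus ` A \<and> A \<subseteq> unit_sphere1 \<mu> \<and> enat k \<le> genus A}"

text \<open>
  For \<open>\<sigma> e \<in> {-1, 1}\<close> the quantity \<open>\<bar>f x - \<sigma> e f y\<bar>\<close> does not depend on the order of
  the end points of \<open>e = {x, y}\<close>; see \<open>edge_variation_eq\<close> below.
\<close>

definition edge_variation :: "('v set \<Rightarrow> real) \<Rightarrow> real ^ 'v::finite \<Rightarrow> 'v set \<Rightarrow> real" where
  "edge_variation \<sigma> f e = (THE r. \<exists>x y. e = {x, y} \<and> r = \<bar>f $ x - \<sigma> e * f $ y\<bar>)"

lemma edge_variation_eq:
  assumes "\<sigma> {x, y} \<in> {-1, 1}"
  shows "edge_variation \<sigma> f {x, y} = \<bar>f $ x - \<sigma> {x, y} * f $ y\<bar>"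
  unfolding edge_variation_def
proof (rule the_equality)
  show "\<exists>x' y'. {x, y} = {x', y'} \<and>
          \<bar>f $ x - \<sigma> {x, y} * f $ y\<bar> = \<bar>f $ x' - \<sigma> {x, y} * f $ y'\<bar>"
    by blast
next
  fix r assume "\<exists>x' y'. {x, y} = {x', y'} \<and> r = \<bar>f $ x' - \<sigma> {x, y} * f $ y'\<bar>"
  then show "r = \<bar>f $ x - \<sigma> {x, y} * f $ y\<bar>"
    using assms by (auto simp: doubleton_eq_iff)
qed

definition rayleigh1 ::
  "'v set set \<Rightarrow> ('v set \<Rightarrow> real) \<Rightarrow> ('v \<Rightarrow> real) \<Rightarrow> ('v set \<Rightarrow> real) \<Rightarrow> real ^ 'v::finite \<Rightarrow> real" where
  "rayleigh1 E w \<mu> \<sigma> f =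
     (\<Sum>e\<in>E. w e * edge_variation \<sigma> f e) / (\<Sum>x\<in>UNIV. \<mu> x * \<bar>f $ x\<bar>)"

definition eigenvalue1 ::
  "'v::finite set set \<Rightarrow> ('v set \<Rightarrow> real) \<Rightarrow> ('v \<Rightarrow> real) \<Rightarrow> ('v set \<Rightarrow> real) \<Rightarrow> nat \<Rightarrow> real" where
  "eigenvalue1 E w \<mu> \<sigma> k = (INF S\<in>genus_family \<mu> k. SUP f\<in>S. rayleigh1 E w \<mu> \<sigma> f)"


section \<open>Signed Cheeger constants\<close>

text \<open>
  With \<open>s = 1\<close> or \<open>s = -1\<close> this is \<open>\<bar>E\<^sup>+(A, B)\<bar>\<close> or \<open>\<bar>E\<^sup>-(A, B)\<bar>\<close>. The sum runs over ordered
  pairs, so for \<open>A = B\<close> every edge inside \<open>A\<close> is counted twice.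
\<close>

definition signed_weight ::
  "'v::finite set set \<Rightarrow> ('v set \<Rightarrow> real) \<Rightarrow> ('v set \<Rightarrow> real) \<Rightarrow> real \<Rightarrow> 'v set \<Rightarrow> 'v set \<Rightarrow> real" where
  "signed_weight E w \<sigma> s A B = (\<Sum>x\<in>A. \<Sum>y | y \<in> B \<and> {x, y} \<in> E \<and> \<sigma> {x, y} = s. w {x, y})"

definition boundary_weight :: "'v::finite set set \<Rightarrow> ('v set \<Rightarrow> real) \<Rightarrow> 'v set \<Rightarrow> real" where
  "boundary_weight E w A = (\<Sum>x\<in>A. \<Sum>y | y \<notin> A \<and> {x, y} \<in> E. w {x, y})"

definition volume :: "('v::finite \<Rightarrow> real) \<Rightarrow> 'v set \<Rightarrow> real" where
  "volume \<mu> A = (\<Sum>x\<in>A. \<mu> x)"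

definition beta ::
  "'v::finite set set \<Rightarrow> ('v set \<Rightarrow> real) \<Rightarrow> ('v \<Rightarrow> real) \<Rightarrow> ('v set \<Rightarrow> real) \<Rightarrow> 'v set \<Rightarrow> 'v set \<Rightarrow> real"
  where
  "beta E w \<mu> \<sigma> A B =
     (2 * signed_weight E w \<sigma> 1 A B + signed_weight E w \<sigma> (-1) A A + signed_weight E w \<sigma> (-1) B B
        + boundary_weight E w (A \<union> B)) / volume \<mu> (A \<union> B)"

definition cheeger_family :: "nat \<Rightarrow> (nat \<Rightarrow> 'v set) \<Rightarrow> bool" where
  "cheeger_family k U \<longleftrightarrow>
     (\<forall>i\<in>{1..k}. U (2 * i - 1) \<inter> U (2 * i) = {} \<and> U (2 * i - 1) \<union> U (2 * i) \<noteq> {}) \<and>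
     (\<forall>i\<in>{1..k}. \<forall>j\<in>{1..k}. i \<noteq> j \<longrightarrow>
        (U (2 * i - 1) \<union> U (2 * i)) \<inter> (U (2 * j - 1) \<union> U (2 * j)) = {})"

definition cheeger ::
  "'v::finite set set \<Rightarrow> ('v set \<Rightarrow> real) \<Rightarrow> ('v \<Rightarrow> real) \<Rightarrow> ('v set \<Rightarrow> real) \<Rightarrow> nat \<Rightarrow> real" where
  "cheeger E w \<mu> \<sigma> k =
     Min {Max ((\<lambda>i. beta E w \<mu> \<sigma> (U (2 * i - 1)) (U (2 * i))) ` {1..k}) | U. cheeger_family k U}"

end

theory Submission
  imports Defs
begin

text \<open>
  Let \<open>mass f = \<Sum>x. \<mu> x * \<bar>f x\<bar>\<close>, and let \<open>variation f\<close> be the weighted sum of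
  \<open>\<bar>f x - \<sigma> e f y\<bar>\<close> over the edges, so that the Rayleigh quotient is \<open>variation f / mass f\<close>.
  The quotient \<open>\<beta>(A, B)\<close> is the Rayleigh quotient of the sign vector \<open>1\<^sub>A - 1\<^sub>B\<close> (\<open>beta_eq\<close>).
  Conversely every vector is a positive combination of sign vectors, its layers, along which both
  \<open>mass\<close> and \<open>variation\<close> are additive. Hence an inequality \<open>h * mass \<le> variation\<close> needs to be
  checked on the layers only (\<open>mass_le_variation_by_layers\<close>), a discrete coarea formula.

  For \<open>k = 1\<close> the genus condition only excludes the empty set, so \<open>\<lambda>\<^sub>1\<close> is the minimum of the Rayleigh
  quotient. A minimising pair \<open>(A, B)\<close> gives the upper bound, and the layers the lower bound.

  For \<open>k = 2\<close> the upper bound holds because two sign vectors with disjoint supports span a circle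
  in the unit sphere, which is connected and hence of genus at least two. On it the
  quotient is at most the larger of the two values of \<open>\<beta>\<close>, because \<open>variation\<close> is
  subadditive and \<open>mass\<close> is additive.

  For the lower bound let \<open>\<tau>\<close> switch the signature to the constant \<open>1\<close>. A symmetric set \<open>S\<close> of
  genus at least two contains some \<open>f\<close> for which \<open>0\<close> is a median of \<open>\<tau> f\<close>: otherwise the sign of
  the medians would be an odd locally constant function on \<open>S\<close>
  (\<open>genus_ge_2_imp_zero_median\<close>). The positive and the negative part of such an \<open>\<tau> f\<close> both have
  support of volume at most half of the total, and so do all their layers. A layer supported on \<open>A\<close>
  has quotient at least \<open>h\<^sub>2\<close>, because the pairs formed from \<open>A\<close> and from its complement are
  admissible for \<open>h\<^sub>2\<close>, and the quotient of \<open>A\<close> is the maximum of the two: the boundaries agree, and \<open>A\<close>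
  has at most the volume of its complement (\<open>cheeger_2_le_switched_indicator\<close>). For an unbalanced
  signature the variation need not be additive on the two parts of \<open>f\<close>, nor be preserved under
  complements.
\<close>

section \<open>Sets of genus at least two\<close>

lemma genus_ge_1: "S \<noteq> {} \<Longrightarrow> enat 1 \<le> genus S"
  by (auto simp: genus_def intro!: INF_greatest)

lemma odd_map_to_1_imp_real_map:
  assumes "odd_map_to 1 S g"
  shows "continuous_on S (\<lambda>x. g x 0)" "\<And>x. x \<in> S \<Longrightarrow> g x 0 \<noteq> 0"
    "\<And>x. x \<in> S \<Longrightarrow> g (- x) 0 = - g x 0"
proof -
  have cm: "continuous_map (top_of_set S) (powertop_real UNIV) g"
    and im: "\<And>x. x \<in> S \<Longrightarrow> (\<forall>i\<ge>1. g x i = 0) \<and> g x \<noteq> (\<lambda>i. 0)"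
    using assms
    by (auto simp: odd_map_to_def Euclidean_space_def continuous_map_in_subtopology)
  show "continuous_on S (\<lambda>x. g x 0)"
    using cm by (simp add: continuous_map_componentwise_UNIV)
  show "g x 0 \<noteq> 0" if "x \<in> S" for x
  proof
    assume "g x 0 = 0"
    then have "g x i = 0" for i
      using im[OF that] by (cases i) auto
    then show False
      using im[OF that] by auto
  qed
  show "\<And>x. x \<in> S \<Longrightarrow> g (- x) 0 = - g x 0"
    using assms by (auto simp: odd_map_to_def)
qed

lemma real_map_imp_odd_map_to_1:
  fixes \<phi> :: "'a::real_normed_vector \<Rightarrow> real"
  assumes "continuous_on S \<phi>" "\<And>x. x \<in> S \<Longrightarrow> \<phi> x \<noteq> 0" "\<And>x. x \<in> S \<Longrightarrow> \<phi> (- x) = - \<phi> x"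
  shows "odd_map_to 1 S (\<lambda>x i. if i = 0 then \<phi> x else 0)"
  using assms
  by (auto simp: odd_map_to_def Euclidean_space_def continuous_map_in_subtopology
      continuous_map_componentwise_UNIV fun_eq_iff)

text \<open>
  The only target that genus at least two has to exclude is \<open>\<real>\<^sup>1\<close> without the origin, and there
  an odd map is a single real-valued function.
\<close>

lemma genus_ge_2_iff:
  fixes S :: "'a::real_normed_vector set"
  shows "enat 2 \<le> genus S \<longleftrightarrow> S \<noteq> {} \<and>
    \<not> (\<exists>\<phi>::'a \<Rightarrow> real. continuous_on S \<phi> \<and> (\<forall>x\<in>S. \<phi> x \<noteq> 0 \<and> \<phi> (- x) = - \<phi> x))"
proof (cases "S = {}")
  case True
  then show ?thesis by (simp add: genus_def zero_enat_def)
next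
  case False
  have "enat 2 \<le> genus S \<longleftrightarrow> (\<forall>k. k \<ge> 1 \<and> (\<exists>g. odd_map_to k S g) \<longrightarrow> 2 \<le> k)"
    using False by (auto simp: genus_def le_INF_iff)
  also have "\<dots> \<longleftrightarrow> \<not> (\<exists>g. odd_map_to 1 S g)"
    by (metis One_nat_def Suc_1 Suc_leI le_neq_implies_less not_less_eq_eq order_refl)
  also have "\<dots> \<longleftrightarrow>
      \<not> (\<exists>\<phi>::'a \<Rightarrow> real. continuous_on S \<phi> \<and> (\<forall>x\<in>S. \<phi> x \<noteq> 0 \<and> \<phi> (- x) = - \<phi> x))"
    using odd_map_to_1_imp_real_map real_map_imp_odd_map_to_1 by blast
  finally show ?thesis using False by simp
qed

text \<open>
  This is the Borsuk--Ulam theorem in its lowest dimension: by the intermediate value theorem an odd real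
  function on a connected symmetric set vanishes somewhere.
\<close>

lemma connected_symmetric_genus_ge_2:
  fixes S :: "'a::real_normed_vector set"
  assumes "connected S" "S \<noteq> {}" "\<And>x. x \<in> S \<Longrightarrow> - x \<in> S"
  shows "enat 2 \<le> genus S"
proof -
  have False if cont: "continuous_on S \<phi>" and odd: "\<forall>x\<in>S. \<phi> x \<noteq> 0 \<and> \<phi> (- x) = - \<phi> x"
    for \<phi> :: "'a \<Rightarrow> real"
  proof -
    obtain a where a: "a \<in> S" using assms(2) by blast
    have conn: "connected (\<phi> ` S)"
      by (rule connected_continuous_image[OF cont assms(1)])
    have mem: "\<phi> a \<in> \<phi> ` S" "- \<phi> a \<in> \<phi> ` S"
      using a assms(3)[OF a] odd by (auto simp: image_iff intro: bexI[of _ "- a"])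
    have "0 \<in> \<phi> ` S"
    proof (cases "\<phi> a \<ge> 0")
      case True
      then show ?thesis using connectedD_interval[OF conn mem(2,1), of 0] by simp
    next
      case False
      then show ?thesis using connectedD_interval[OF conn mem(1,2), of 0] by simp
    qed
    then show False using odd by auto
  qed
  then show ?thesis using assms(2) by (auto simp: genus_ge_2_iff)
qed

section \<open>Mass and variation\<close>

definition sign_vector :: "'v::finite set \<Rightarrow> 'v set \<Rightarrow> real ^ 'v" where
  "sign_vector A B = (\<chi> x. indicator A x - indicator B x)"

context signed_graph
begin

definition mass :: "real ^ 'v \<Rightarrow> real" where
  "mass f = (\<Sum>x\<in>UNIV. \<mu> x * \<bar>f $ x\<bar>)"

definition variation :: "real ^ 'v \<Rightarrow> real" where
  "variation f = (\<Sum>e\<in>E. w e * edge_variation \<sigma> f e)"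

lemma rayleigh1_eq: "rayleigh1 E w \<mu> \<sigma> f = variation f / mass f"
  by (simp add: rayleigh1_def variation_def mass_def)

lemma edgeE:
  assumes "e \<in> E"
  obtains x y where "e = {x, y}" "x \<noteq> y"
    "\<And>f. edge_variation \<sigma> f e = \<bar>f $ x - \<sigma> e * f $ y\<bar>"
proof -
  obtain x y where e: "e = {x, y}" "x \<noteq> y"
    using edges[OF assms] by (auto simp: card_2_iff)
  with that show thesis
    using edge_variation_eq[of \<sigma> x y] signature[OF assms] by blast
qed

lemma mass_nonneg: "0 \<le> mass f"
  unfolding mass_def using vertex_weight_pos by (intro sum_nonneg) (simp add: less_imp_le)

lemma mass_eq_0_iff: "mass f = 0 \<longleftrightarrow> f = 0"
proof -
  have "mass f = 0 \<longleftrightarrow> (\<forall>x. \<mu> x * \<bar>f $ x\<bar> = 0)"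
    unfolding mass_def using vertex_weight_pos
    by (subst sum_nonneg_eq_0_iff) (auto simp: less_imp_le)
  also have "\<dots> \<longleftrightarrow> f = 0"
    using vertex_weight_pos by (auto simp: vec_eq_iff less_le)
  finally show ?thesis .
qed

lemma mass_pos: "f \<noteq> 0 \<Longrightarrow> 0 < mass f"
  using mass_nonneg[of f] mass_eq_0_iff[of f] by linarith

lemma mass_scaleR: "mass (c *\<^sub>R f) = \<bar>c\<bar> * mass f"
  by (simp add: mass_def sum_distrib_left abs_mult mult_ac)

lemma variation_scaleR: "variation (c *\<^sub>R f) = \<bar>c\<bar> * variation f"
proof -
  have "edge_variation \<sigma> (c *\<^sub>R f) e = \<bar>c\<bar> * edge_variation \<sigma> f e" if "e \<in> E" for e
    using that
  proof (rule edgeE)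
    fix x y assume *: "\<And>f. edge_variation \<sigma> f e = \<bar>f $ x - \<sigma> e * f $ y\<bar>"
    show ?thesis
      unfolding * abs_mult[symmetric] by (simp add: algebra_simps)
  qed
  then show ?thesis
    by (simp add: variation_def sum_distrib_left mult_ac)
qed

lemma mass_add:
  assumes "\<And>x. 0 \<le> f $ x * g $ x"
  shows "mass (f + g) = mass f + mass g"
proof -
  have "\<bar>f $ x + g $ x\<bar> = \<bar>f $ x\<bar> + \<bar>g $ x\<bar>" for x
    using assms[of x] by (auto simp: zero_le_mult_iff)
  then show ?thesis
    by (simp add: mass_def algebra_simps sum.distrib)
qed

text \<open>
  The hypothesis says that the contributions of \<open>f\<close> and \<open>g\<close> on each edge do not have opposite
  signs, so that no cancellation occurs inside the absolute values.
\<close>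

lemma variation_add:
  assumes "\<And>x y. {x, y} \<in> E \<Longrightarrow>
    0 \<le> (f $ x - \<sigma> {x, y} * f $ y) * (g $ x - \<sigma> {x, y} * g $ y)"
  shows "variation (f + g) = variation f + variation g"
proof -
  have "edge_variation \<sigma> (f + g) e = edge_variation \<sigma> f e + edge_variation \<sigma> g e"
    if "e \<in> E" for e
    using that
  proof (rule edgeE)
    fix x y assume e: "e = {x, y}" and *: "\<And>f. edge_variation \<sigma> f e = \<bar>f $ x - \<sigma> e * f $ y\<bar>"
    have eq: "(f + g) $ x - \<sigma> e * (f + g) $ y = (f $ x - \<sigma> e * f $ y) + (g $ x - \<sigma> e * g $ y)"
      by (simp add: algebra_simps)
    have "0 \<le> (f $ x - \<sigma> e * f $ y) * (g $ x - \<sigma> e * g $ y)"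
      using assms[of x y] that e by simp
    then show ?thesis
      unfolding * eq by (auto simp: zero_le_mult_iff)
  qed
  then show ?thesis
    by (simp add: variation_def algebra_simps sum.distrib)
qed

lemma variation_triangle: "variation (f + g) \<le> variation f + variation g"
proof -
  have "edge_variation \<sigma> (f + g) e \<le> edge_variation \<sigma> f e + edge_variation \<sigma> g e"
    if "e \<in> E" for e
    using that
  proof (rule edgeE)
    fix x y assume *: "\<And>f. edge_variation \<sigma> f e = \<bar>f $ x - \<sigma> e * f $ y\<bar>"
    show ?thesis
      unfolding * vector_add_component ring_distribs by linarith
  qed
  then have "variation (f + g) \<le> (\<Sum>e\<in>E. w e * (edge_variation \<sigma> f e + edge_variation \<sigma> g e))"
    unfolding variation_def
    by (intro sum_mono mult_left_mono) (auto simp: edge_measure_pos less_imp_le)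
  then show ?thesis
    by (simp add: variation_def algebra_simps sum.distrib)
qed

lemma continuous_on_mass: "continuous_on S mass"
  unfolding mass_def by (intro continuous_intros)

lemma continuous_on_variation: "continuous_on S variation"
  unfolding variation_def
proof (intro continuous_intros)
  fix e assume "e \<in> E"
  then show "continuous_on S (\<lambda>f. edge_variation \<sigma> f e)"
  proof (rule edgeE)
    fix x y assume *: "\<And>f. edge_variation \<sigma> f e = \<bar>f $ x - \<sigma> e * f $ y\<bar>"
    show ?thesis unfolding * by (intro continuous_intros)
  qed
qed

section \<open>The Cheeger quotient as a Rayleigh quotient\<close>

text \<open>
  The Rayleigh quotient sums over unordered edges, the Cheeger quotient over ordered pairs. Each edge
  is met twice by the latter.
\<close>

lemma sum_ordered_edges:
  fixes F :: "'v set \<Rightarrow> real"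
  shows "(\<Sum>x\<in>UNIV. \<Sum>y\<in>UNIV. if {x, y} \<in> E then F {x, y} else 0) = 2 * (\<Sum>e\<in>E. F e)"
proof -
  have "(\<Sum>x\<in>UNIV. \<Sum>y\<in>UNIV. if {x, y} \<in> E then F {x, y} else 0)
      = (\<Sum>(x, y)\<in>UNIV. if {x, y} \<in> E then F {x, y} else 0)"
    by (simp add: sum.cartesian_product)
  also have "\<dots> = (\<Sum>(x, y)\<in>{(x, y). {x, y} \<in> E}. F {x, y})"
    by (rule sum.mono_neutral_cong_right) (auto split: if_splits)
  also have "\<dots> = (\<Sum>e\<in>E. \<Sum>p | p \<in> {(x, y). {x, y} \<in> E} \<and> {fst p, snd p} = e. F {fst p, snd p})"
    by (subst sum.group) (auto simp: case_prod_unfold)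
  also have "\<dots> = (\<Sum>e\<in>E. 2 * F e)"
  proof (rule sum.cong[OF refl])
    fix e assume e: "e \<in> E"
    then show "(\<Sum>p | p \<in> {(x, y). {x, y} \<in> E} \<and> {fst p, snd p} = e. F {fst p, snd p}) = 2 * F e"
    proof (rule edgeE)
      fix x y assume xy: "e = {x, y}" "x \<noteq> y"
      have swap: "{y, x} = {x, y}" by (rule insert_commute)
      have yx: "{y, x} \<in> E" unfolding swap using e xy(1) by simp
      have "{p. p \<in> {(x, y). {x, y} \<in> E} \<and> {fst p, snd p} = e} = {(x, y), (y, x)}"
        using e xy yx by (auto simp: doubleton_eq_iff)
      then show ?thesis using xy swap by simp
    qed
  qed
  finally show ?thesis by (simp add: sum_distrib_left)
qed

lemma two_variation_eq:
  "2 * variation f = (\<Sum>x\<in>UNIV. \<Sum>y\<in>UNIV.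
     if {x, y} \<in> E then w {x, y} * \<bar>f $ x - \<sigma> {x, y} * f $ y\<bar> else 0)"
proof -
  have "(\<Sum>x\<in>UNIV. \<Sum>y\<in>UNIV. if {x, y} \<in> E then w {x, y} * edge_variation \<sigma> f {x, y} else 0)
      = 2 * variation f"
    unfolding variation_def by (rule sum_ordered_edges)
  moreover have "(if {x, y} \<in> E then w {x, y} * edge_variation \<sigma> f {x, y} else 0)
      = (if {x, y} \<in> E then w {x, y} * \<bar>f $ x - \<sigma> {x, y} * f $ y\<bar> else 0)" for x y
    using signature[of "{x, y}"] edge_variation_eq[of \<sigma> x y f] by simp
  ultimately show ?thesis by simp
qed

lemma signed_weight_eq:
  "signed_weight E w \<sigma> s A B = (\<Sum>x\<in>UNIV. \<Sum>y\<in>UNIV.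
     if x \<in> A \<and> y \<in> B \<and> {x, y} \<in> E \<and> \<sigma> {x, y} = s then w {x, y} else 0)"
  unfolding signed_weight_def
  by (rule sum.mono_neutral_cong_left) (auto intro!: sum.mono_neutral_cong_left split: if_splits)

lemma signed_weight_commute: "signed_weight E w \<sigma> s A B = signed_weight E w \<sigma> s B A"
  unfolding signed_weight_eq
  by (subst sum.swap) (auto intro!: sum.cong simp: insert_commute)

lemma boundary_weight_eq:
  "boundary_weight E w A =
     (\<Sum>x\<in>UNIV. \<Sum>y\<in>UNIV. if x \<in> A \<and> y \<notin> A \<and> {x, y} \<in> E then w {x, y} else 0)"
  unfolding boundary_weight_def
  by (rule sum.mono_neutral_cong_left) (auto intro!: sum.mono_neutral_cong_left split: if_splits)

lemma boundary_weight_eq':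
  "boundary_weight E w A =
     (\<Sum>x\<in>UNIV. \<Sum>y\<in>UNIV. if x \<notin> A \<and> y \<in> A \<and> {x, y} \<in> E then w {x, y} else 0)"
  unfolding boundary_weight_eq
  by (subst sum.swap) (auto intro!: sum.cong simp: insert_commute)

text \<open>
  For \<open>f = 1\<^sub>A - 1\<^sub>B\<close> the value \<open>\<bar>f x - \<sigma> f y\<bar>\<close> is \<open>2\<close> on positive edges between \<open>A\<close> and \<open>B\<close> and on
  negative edges inside \<open>A\<close> or inside \<open>B\<close>, it is \<open>1\<close> on edges that leave \<open>A \<union> B\<close>, and \<open>0\<close> on all
  others. The negative weights appear without a factor \<open>2\<close> because they already count each edge twice.
\<close>

lemma variation_sign_vector:
  assumes "A \<inter> B = {}"
  shows "variation (sign_vector A B) =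
    2 * signed_weight E w \<sigma> 1 A B + signed_weight E w \<sigma> (-1) A A + signed_weight E w \<sigma> (-1) B B
      + boundary_weight E w (A \<union> B)"
proof -
  \<comment> \<open>The terms that are asymmetric in \<open>x\<close> and \<open>y\<close> occur in both orientations, so that the identity
    holds for each ordered pair and not only after summation.\<close>
  have pointwise: "(if {x, y} \<in> E then w {x, y} *
        \<bar>sign_vector A B $ x - \<sigma> {x, y} * sign_vector A B $ y\<bar> else 0) =
      2 * (if x \<in> A \<and> y \<in> B \<and> {x, y} \<in> E \<and> \<sigma> {x, y} = 1 then w {x, y} else 0)
      + 2 * (if x \<in> B \<and> y \<in> A \<and> {x, y} \<in> E \<and> \<sigma> {x, y} = 1 then w {x, y} else 0)
      + 2 * (if x \<in> A \<and> y \<in> A \<and> {x, y} \<in> E \<and> \<sigma> {x, y} = -1 then w {x, y} else 0)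
      + 2 * (if x \<in> B \<and> y \<in> B \<and> {x, y} \<in> E \<and> \<sigma> {x, y} = -1 then w {x, y} else 0)
      + (if x \<in> A \<union> B \<and> y \<notin> A \<union> B \<and> {x, y} \<in> E then w {x, y} else 0)
      + (if x \<notin> A \<union> B \<and> y \<in> A \<union> B \<and> {x, y} \<in> E then w {x, y} else 0)" for x y
  proof (cases "{x, y} \<in> E")
    case True
    have AB: "x \<in> A \<Longrightarrow> x \<notin> B" "y \<in> A \<Longrightarrow> y \<notin> B" using assms by auto
    have "\<sigma> {x, y} = 1 \<or> \<sigma> {x, y} = -1" using signature[OF True] by auto
    then show ?thesis
    proof
      assume "\<sigma> {x, y} = 1"
      with True AB show ?thesis
        by (cases "x \<in> A"; cases "x \<in> B"; cases "y \<in> A"; cases "y \<in> B")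
          (simp_all add: sign_vector_def)
    next
      assume "\<sigma> {x, y} = -1"
      with True AB show ?thesis
        by (cases "x \<in> A"; cases "x \<in> B"; cases "y \<in> A"; cases "y \<in> B")
          (simp_all add: sign_vector_def)
    qed
  qed simp
  have "2 * variation (sign_vector A B) =
      2 * signed_weight E w \<sigma> 1 A B + 2 * signed_weight E w \<sigma> 1 B A
      + 2 * signed_weight E w \<sigma> (-1) A A + 2 * signed_weight E w \<sigma> (-1) B B
      + boundary_weight E w (A \<union> B) + boundary_weight E w (A \<union> B)"
    unfolding two_variation_eq pointwise sum.distrib sum_distrib_left[symmetric]
      signed_weight_eq[symmetric] boundary_weight_eq[symmetric] boundary_weight_eq'[symmetric] ..
  then show ?thesis
    using signed_weight_commute[of 1 A B] by simp
qed

lemma mass_sign_vector: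
  assumes "A \<inter> B = {}"
  shows "mass (sign_vector A B) = volume \<mu> (A \<union> B)"
proof -
  have "\<mu> x * \<bar>sign_vector A B $ x\<bar> = (if x \<in> A \<union> B then \<mu> x else 0)" for x
    using assms by (auto simp: sign_vector_def indicator_def)
  then show ?thesis
    by (simp add: mass_def volume_def sum.If_cases Un_def)
qed

lemma beta_eq:
  assumes "A \<inter> B = {}"
  shows "beta E w \<mu> \<sigma> A B = variation (sign_vector A B) / mass (sign_vector A B)"
  using assms by (simp add: beta_def variation_sign_vector mass_sign_vector)

lemma sign_vector_nonzero:
  "A \<inter> B = {} \<Longrightarrow> A \<union> B \<noteq> {} \<Longrightarrow> sign_vector A B \<noteq> (0 :: real ^ 'v)"
  by (auto simp: sign_vector_def vec_eq_iff indicator_def)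

section \<open>Layer decomposition\<close>

text \<open>
  Removing from \<open>f\<close> a multiple of its sign vector that is small enough reverses no sign, so the
  two summands never disagree in sign, neither at a vertex nor across an edge.
\<close>

lemma variation_layer:
  fixes f :: "real ^ 'v"
  defines "s \<equiv> \<chi> x. sgn (f $ x)"
  assumes m: "0 \<le> m" "\<And>x. f $ x \<noteq> 0 \<Longrightarrow> m \<le> \<bar>f $ x\<bar>"
  shows "variation f = m * variation s + variation (f - m *\<^sub>R s)"
    and "mass f = m * mass s + mass (f - m *\<^sub>R s)"
proof -
  have f: "f = m *\<^sub>R s + (f - m *\<^sub>R s)" by simp
  have "variation f = variation (m *\<^sub>R s) + variation (f - m *\<^sub>R s)"
  proof (subst f, rule variation_add)
    fix x y assume e: "{x, y} \<in> E"
    define a b where "a = \<bar>f $ x\<bar> - m" and "b = \<bar>f $ y\<bar> - m"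
    have ab: "f $ x \<noteq> 0 \<Longrightarrow> 0 \<le> a" "f $ y \<noteq> 0 \<Longrightarrow> 0 \<le> b"
      using m(2) by (auto simp: a_def b_def)
    have r: "(f - m *\<^sub>R s) $ z = sgn (f $ z) * (\<bar>f $ z\<bar> - m)" for z
      by (simp add: s_def algebra_simps abs_sgn)
    have "0 \<le> (sgn (f $ x) - \<sigma> {x, y} * sgn (f $ y)) *
        (sgn (f $ x) * a - \<sigma> {x, y} * (sgn (f $ y) * b))"
      using ab signature[OF e] by (auto simp: sgn_if)
    from mult_nonneg_nonneg[OF m(1) this] show "0 \<le> ((m *\<^sub>R s) $ x - \<sigma> {x, y} * (m *\<^sub>R s) $ y) *
        ((f - m *\<^sub>R s) $ x - \<sigma> {x, y} * (f - m *\<^sub>R s) $ y)"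
      unfolding r a_def b_def by (simp add: s_def algebra_simps)
  qed
  then show "variation f = m * variation s + variation (f - m *\<^sub>R s)"
    using m(1) by (simp add: variation_scaleR)
  have "mass f = mass (m *\<^sub>R s) + mass (f - m *\<^sub>R s)"
  proof (subst f, rule mass_add)
    fix x show "0 \<le> (m *\<^sub>R s) $ x * (f - m *\<^sub>R s) $ x"
      using m(1) m(2)[of x]
      by (cases "f $ x" "0::real" rule: linorder_cases) (auto simp: s_def mult_nonneg_nonpos)
  qed
  then show "mass f = m * mass s + mass (f - m *\<^sub>R s)"
    using m(1) by (simp add: mass_scaleR)
qed

text \<open>
  Subtract from \<open>f\<close> the multiple \<open>m\<close> of its sign vector, where \<open>m\<close> is the least nonzero value of
  \<open>\<bar>f\<bar>\<close>. This shrinks the support, and the inequality adds up over the layers. The layers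
  that occur have the signs of \<open>f\<close> on a subset of its support. Keeping this information is essential
  for the second eigenvalue, where the inequality is available for small supports only.
\<close>

lemma mass_le_variation_by_layers:
  assumes "\<And>s. s \<noteq> 0 \<Longrightarrow> (\<And>x. s $ x \<in> {0, sgn (f $ x)}) \<Longrightarrow> h * mass s \<le> variation s"
  shows "h * mass f \<le> variation f"
  using assms
proof (induction "card {x. f $ x \<noteq> 0}" arbitrary: f rule: less_induct)
  case less
  show ?case
  proof (cases "f = 0")
    case True
    then show ?thesis
      using mass_scaleR[of 0 f] variation_scaleR[of 0 f] by simp
  next
    case False
    define s :: "real ^ 'v" where "s = (\<chi> x. sgn (f $ x))"
    define m where "m = Min ((\<lambda>x. \<bar>f $ x\<bar>) ` {x. f $ x \<noteq> 0})"
    define r where "r = f - m *\<^sub>R s"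
    have ne: "{x. f $ x \<noteq> 0} \<noteq> {}" using False by (auto simp: vec_eq_iff)
    have "m \<in> (\<lambda>x. \<bar>f $ x\<bar>) ` {x. f $ x \<noteq> 0}"
      unfolding m_def using ne by (intro Min_in) auto
    then obtain z where z: "f $ z \<noteq> 0" "m = \<bar>f $ z\<bar>" by auto
    have m_le: "m \<le> \<bar>f $ x\<bar>" if "f $ x \<noteq> 0" for x
      unfolding m_def using that by (intro Min_le) auto
    have r: "r $ x = sgn (f $ x) * (\<bar>f $ x\<bar> - m)" for x
      by (simp add: r_def s_def algebra_simps abs_sgn)
    have "{x. r $ x \<noteq> 0} \<subset> {x. f $ x \<noteq> 0}"
      using z by (auto simp: r)
    then have card: "card {x. r $ x \<noteq> 0} < card {x. f $ x \<noteq> 0}"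
      by (intro psubset_card_mono) auto
    have sgn_r: "sgn (r $ x) \<in> {0, sgn (f $ x)}" for x
      using m_le[of x]
      by (cases "f $ x" "0::real" rule: linorder_cases) (auto simp: r sgn_if)
    have "h * mass r \<le> variation r"
    proof (rule less.hyps[OF card])
      fix t :: "real ^ 'v" assume "t \<noteq> 0" and t: "\<And>x. t $ x \<in> {0, sgn (r $ x)}"
      have "t $ x \<in> {0, sgn (f $ x)}" for x using t[of x] sgn_r[of x] by auto
      with \<open>t \<noteq> 0\<close> show "h * mass t \<le> variation t" by (rule less.prems)
    qed
    moreover have "m * (h * mass s) \<le> m * variation s"
    proof (rule mult_left_mono)
      show "h * mass s \<le> variation s"
        using z by (intro less.prems) (auto simp: s_def vec_eq_iff sgn_0_0)
    qed (use z in simp)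
    moreover have "variation f = m * variation s + variation r" "mass f = m * mass s + mass r"
      using variation_layer[of m f] z m_le unfolding s_def r_def by auto
    ultimately show ?thesis by (simp add: algebra_simps)
  qed
qed

section \<open>The variational eigenvalue\<close>

lemma unit_sphere1_iff: "f \<in> unit_sphere1 \<mu> \<longleftrightarrow> mass f = 1"
  by (simp add: unit_sphere1_def mass_def)

text \<open>
  On the unit sphere the Rayleigh quotient is the variation. Compactness of the members of the family
  makes the suprema genuine, so that a single vector in each member gives a lower bound.
\<close>

lemma eigenvalue1_eqI:
  assumes k: "1 \<le> k"
    and S: "S \<in> genus_family \<mu> k" "\<And>f. f \<in> S \<Longrightarrow> variation f \<le> c"
    and lower: "\<And>T. T \<in> genus_family \<mu> k \<Longrightarrow> \<exists>f\<in>T. c \<le> variation f"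
  shows "eigenvalue1 E w \<mu> \<sigma> k = c"
proof -
  have R: "rayleigh1 E w \<mu> \<sigma> f = variation f" if "f \<in> T" "T \<in> genus_family \<mu> k" for f T
    using that by (auto simp: rayleigh1_eq genus_family_def unit_sphere1_iff dest!: subsetD)
  have ge: "c \<le> (SUP f\<in>T. rayleigh1 E w \<mu> \<sigma> f)" if T: "T \<in> genus_family \<mu> k" for T
  proof -
    obtain f where f: "f \<in> T" "c \<le> variation f" using lower[OF T] by blast
    have "compact (variation ` T)"
      using T by (intro compact_continuous_image continuous_on_variation) (simp add: genus_family_def)
    then have "bdd_above (variation ` T)"
      by (intro bounded_imp_bdd_above compact_imp_bounded)
    then have "variation f \<le> (SUP f\<in>T. variation f)"
      by (intro cSUP_upper f)
    then show ?thesis using f(2) R[OF _ T] by simp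
  qed
  have "S \<noteq> {}"
    using S(1) k by (auto simp: genus_family_def genus_def zero_enat_def)
  then have "(SUP f\<in>S. rayleigh1 E w \<mu> \<sigma> f) \<le> c"
    using S(2) R[OF _ S(1)] by (intro cSUP_least) auto
  moreover have "eigenvalue1 E w \<mu> \<sigma> k \<le> (SUP f\<in>S. rayleigh1 E w \<mu> \<sigma> f)"
    unfolding eigenvalue1_def using ge by (intro cINF_lower S(1) bdd_belowI2)
  moreover have "c \<le> eigenvalue1 E w \<mu> \<sigma> k"
    unfolding eigenvalue1_def using S(1) ge by (intro cINF_greatest) auto
  ultimately show ?thesis by simp
qed

lemma genus_family_1_pair:
  assumes "f \<noteq> 0"
  defines "g \<equiv> (1 / mass f) *\<^sub>R f"
  shows "{g, - g} \<in> genus_family \<mu> 1"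
proof -
  have "mass g = 1" using mass_pos[OF assms(1)] by (simp add: g_def mass_scaleR)
  moreover have "mass (- g) = mass g" by (simp add: mass_def)
  ultimately show ?thesis
    using genus_ge_1[of "{g, - g}"] by (auto simp: genus_family_def unit_sphere1_iff)
qed

text \<open>
  The set is the unit circle of the plane spanned by \<open>f\<close> and \<open>g\<close>, parametrised by the
  complex numbers of modulus one. Disjoint supports make the mass additive on the plane, hence positive
  away from the origin, so that the parametrisation can be normalised.
\<close>

lemma genus_family_2_circle:
  fixes f g :: "real ^ 'v"
  assumes nz: "f \<noteq> 0" "g \<noteq> 0" and disj: "\<And>x. f $ x * g $ x = 0"
  obtains S where "S \<in> genus_family \<mu> 2"
    "\<And>u. u \<in> S \<Longrightarrow> \<exists>a b. u = a *\<^sub>R f + b *\<^sub>R g \<and> \<bar>a\<bar> * mass f + \<bar>b\<bar> * mass g = 1"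
proof
  define T where "T z = Re z *\<^sub>R f + Im z *\<^sub>R g" for z
  define S where "S = (\<lambda>z. (1 / mass (T z)) *\<^sub>R T z) ` sphere 0 1"
  have mass_comb: "mass (a *\<^sub>R f + b *\<^sub>R g) = \<bar>a\<bar> * mass f + \<bar>b\<bar> * mass g" for a b
  proof -
    have "(a *\<^sub>R f) $ x * (b *\<^sub>R g) $ x = 0" for x using disj[of x] by auto
    then have "mass (a *\<^sub>R f + b *\<^sub>R g) = mass (a *\<^sub>R f) + mass (b *\<^sub>R g)"
      by (intro mass_add) (simp only: order_refl)
    then show ?thesis by (simp add: mass_scaleR)
  qed
  have pos: "0 < mass (T z)" if "z \<in> sphere 0 1" for z
  proof -
    have "z \<noteq> 0" using that by auto
    then have "Re z \<noteq> 0 \<or> Im z \<noteq> 0" by (simp add: complex_eq_iff)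
    then show ?thesis
      unfolding T_def mass_comb using mass_pos nz
      by (auto intro: add_pos_nonneg add_nonneg_pos simp: mass_nonneg)
  qed
  have cont: "continuous_on (sphere 0 1) (\<lambda>z. (1 / mass (T z)) *\<^sub>R T z)"
  proof -
    have "continuous_on (sphere 0 1) T" unfolding T_def by (intro continuous_intros)
    moreover from this have "continuous_on (sphere 0 1) (\<lambda>z. mass (T z))"
      by (rule continuous_on_compose2[OF continuous_on_mass]) auto
    ultimately show ?thesis using pos by (intro continuous_intros) (auto simp: less_le)
  qed
  have unit: "mass u = 1" if "u \<in> S" for u
  proof -
    obtain z where z: "z \<in> sphere 0 1" "u = (1 / mass (T z)) *\<^sub>R T z"
      using \<open>u \<in> S\<close> unfolding S_def by blast
    then show ?thesis using pos[OF z(1)] by (simp add: mass_scaleR)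
  qed
  have minus: "- u \<in> S" if "u \<in> S" for u
  proof -
    obtain z where z: "z \<in> sphere 0 1" "u = (1 / mass (T z)) *\<^sub>R T z"
      using \<open>u \<in> S\<close> unfolding S_def by blast
    have "T (- z) = (-1) *\<^sub>R T z" by (simp add: T_def)
    then have "- u = (1 / mass (T (- z))) *\<^sub>R T (- z)"
      using z(2) by (simp only: mass_scaleR) simp
    then show ?thesis using z(1) unfolding S_def by (intro image_eqI[of _ _ "- z"]) auto
  qed
  have "compact S" unfolding S_def by (intro compact_continuous_image cont compact_sphere)
  moreover have "S = uminus ` S" using minus by (auto intro: image_eqI[of _ uminus "- x" for x])
  moreover have "enat 2 \<le> genus S"
  proof (rule connected_symmetric_genus_ge_2)
    show "connected S"
      unfolding S_def by (intro connected_continuous_image cont connected_sphere) simp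
    have "1 \<in> sphere (0::complex) 1" by simp
    then show "S \<noteq> {}" unfolding S_def by blast
  qed (rule minus)
  ultimately show "S \<in> genus_family \<mu> 2"
    using unit by (auto simp: genus_family_def unit_sphere1_iff)
  show "\<exists>a b. u = a *\<^sub>R f + b *\<^sub>R g \<and> \<bar>a\<bar> * mass f + \<bar>b\<bar> * mass g = 1" if "u \<in> S" for u
  proof -
    obtain z where "u = (1 / mass (T z)) *\<^sub>R T z" using \<open>u \<in> S\<close> unfolding S_def by blast
    then have "u = (1 / mass (T z) * Re z) *\<^sub>R f + (1 / mass (T z) * Im z) *\<^sub>R g"
      by (simp add: T_def algebra_simps)
    then show ?thesis using unit[OF that] mass_comb by metis
  qed
qed

section \<open>Cheeger constants\<close>

text \<open>
  There are infinitely many families, since they are functions on \<open>nat\<close>, but only finitely many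
  pairs of vertex sets and hence finitely many values.
\<close>

lemma finite_cheeger_values:
  "finite {Max ((\<lambda>i. beta E w \<mu> \<sigma> (U (2 * i - 1)) (U (2 * i))) ` {1..k}) | U. cheeger_family k U}"
proof (rule finite_subset)
  show "{Max ((\<lambda>i. beta E w \<mu> \<sigma> (U (2 * i - 1)) (U (2 * i))) ` {1..k}) | U. cheeger_family k U}
      \<subseteq> Max ` Pow (range (\<lambda>(A, B). beta E w \<mu> \<sigma> A B))"
    by (auto intro!: imageI)
qed simp

lemma cheeger_le:
  "cheeger_family k U \<Longrightarrow>
    cheeger E w \<mu> \<sigma> k \<le> Max ((\<lambda>i. beta E w \<mu> \<sigma> (U (2 * i - 1)) (U (2 * i))) ` {1..k})"
  unfolding cheeger_def by (intro Min_le finite_cheeger_values) auto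

lemma cheeger_attained:
  assumes "cheeger_family k (V :: nat \<Rightarrow> 'v set)"
  obtains U where "cheeger_family k U"
    "\<And>i. i \<in> {1..k} \<Longrightarrow> beta E w \<mu> \<sigma> (U (2 * i - 1)) (U (2 * i)) \<le> cheeger E w \<mu> \<sigma> k"
proof -
  have "cheeger E w \<mu> \<sigma> k \<in>
      {Max ((\<lambda>i. beta E w \<mu> \<sigma> (U (2 * i - 1)) (U (2 * i))) ` {1..k}) | U. cheeger_family k U}"
    unfolding cheeger_def using assms by (intro Min_in finite_cheeger_values) blast
  then obtain V where "cheeger_family k V"
    "cheeger E w \<mu> \<sigma> k = Max ((\<lambda>i. beta E w \<mu> \<sigma> (V (2 * i - 1)) (V (2 * i))) ` {1..k})"
    by auto
  then show thesis by (intro that) auto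
qed

lemma variation_sign_vector_le:
  assumes "A \<inter> B = {}" "A \<union> B \<noteq> {}" "beta E w \<mu> \<sigma> A B \<le> c"
  shows "variation (sign_vector A B) \<le> c * mass (sign_vector A B)"
  using assms mass_pos[OF sign_vector_nonzero[OF assms(1,2)]]
  by (simp add: beta_eq divide_le_eq)

definition two_pairs :: "'v set \<Rightarrow> 'v set \<Rightarrow> 'v set \<Rightarrow> 'v set \<Rightarrow> nat \<Rightarrow> 'v set" where
  "two_pairs A B C D i = (if i = 1 then A else if i = 2 then B else if i = 3 then C else D)"

lemma cheeger_1_le:
  assumes "A \<inter> B = {}" "A \<union> B \<noteq> {}"
  shows "cheeger E w \<mu> \<sigma> 1 \<le> beta E w \<mu> \<sigma> A B"
proof -
  have "cheeger_family 1 (two_pairs A B {} {})"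
    using assms by (auto simp: cheeger_family_def two_pairs_def)
  from cheeger_le[OF this] show ?thesis by (simp add: two_pairs_def)
qed

lemma cheeger_family_2_two_pairs:
  assumes "A \<inter> B = {}" "A \<union> B \<noteq> {}" "C \<inter> D = {}" "C \<union> D \<noteq> {}" "(A \<union> B) \<inter> (C \<union> D) = {}"
  shows "cheeger_family 2 (two_pairs A B C D)"
proof -
  have "{1..2::nat} = {1, 2}" by auto
  then show ?thesis
    using assms by (auto simp: cheeger_family_def two_pairs_def)
qed

lemma cheeger_2_le:
  assumes "A \<inter> B = {}" "A \<union> B \<noteq> {}" "C \<inter> D = {}" "C \<union> D \<noteq> {}" "(A \<union> B) \<inter> (C \<union> D) = {}"
  shows "cheeger E w \<mu> \<sigma> 2 \<le> max (beta E w \<mu> \<sigma> A B) (beta E w \<mu> \<sigma> C D)"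
proof -
  have "{1..2::nat} = {1, 2}" by auto
  then show ?thesis
    using cheeger_le[OF cheeger_family_2_two_pairs[OF assms]] by (simp add: two_pairs_def)
qed

section \<open>The first eigenvalue\<close>

lemma eigenvalue1_1_eq_cheeger: "eigenvalue1 E w \<mu> \<sigma> 1 = cheeger E w \<mu> \<sigma> 1"
proof -
  let ?h = "cheeger E w \<mu> \<sigma> 1"
  have "cheeger_family 1 (two_pairs {undefined} {} {} {})"
    by (auto simp: cheeger_family_def two_pairs_def)
  then obtain U where U: "cheeger_family 1 U"
    "\<And>i. i \<in> {1..1} \<Longrightarrow> beta E w \<mu> \<sigma> (U (2 * i - 1)) (U (2 * i)) \<le> ?h"
    by (rule cheeger_attained) blast
  have disj: "U 1 \<inter> U 2 = {}" "U 1 \<union> U 2 \<noteq> {}" and le: "beta E w \<mu> \<sigma> (U 1) (U 2) \<le> ?h"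
    using U(1) U(2)[of 1] by (auto simp: cheeger_family_def)
  let ?f = "sign_vector (U 1) (U 2)"
  have f: "?f \<noteq> 0" "variation ?f \<le> ?h * mass ?f"
    by (rule sign_vector_nonzero[OF disj], rule variation_sign_vector_le[OF disj le])
  show ?thesis
  proof (rule eigenvalue1_eqI[OF _ genus_family_1_pair[OF f(1)]])
    fix u assume "u \<in> {(1 / mass ?f) *\<^sub>R ?f, - ((1 / mass ?f) *\<^sub>R ?f)}"
    then have "variation u = variation ((1 / mass ?f) *\<^sub>R ?f)"
      using variation_scaleR[of "-1" "(1 / mass ?f) *\<^sub>R ?f"] by auto
    also have "\<dots> = variation ?f / mass ?f"
      using mass_nonneg[of ?f] by (simp add: variation_scaleR)
    also have "\<dots> \<le> ?h" using f mass_pos[OF f(1)] by (simp add: divide_le_eq)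
    finally show "variation u \<le> ?h" .
  next
    fix T assume T: "T \<in> genus_family \<mu> 1"
    then have "T \<noteq> {}" by (auto simp: genus_family_def genus_def zero_enat_def)
    then obtain u where u: "u \<in> T" by blast
    have "mass u = 1" using u T by (auto simp: genus_family_def unit_sphere1_iff)
    moreover have "?h * mass u \<le> variation u"
    proof (rule mass_le_variation_by_layers)
      fix s :: "real ^ 'v" assume "s \<noteq> 0" and s: "\<And>x. s $ x \<in> {0, sgn (u $ x)}"
      let ?A = "{x. s $ x = 1}" and ?B = "{x. s $ x = -1}"
      have vals: "s $ x \<in> {0, 1, -1}" for x using s[of x] by (auto simp: sgn_if split: if_splits)
      then have s_eq: "s = sign_vector ?A ?B"
        by (auto simp: vec_eq_iff sign_vector_def indicator_def)
      have disj: "?A \<inter> ?B = {}" "?A \<union> ?B \<noteq> {}"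
        using vals \<open>s \<noteq> 0\<close> by (auto simp: vec_eq_iff)
      have "?h \<le> variation s / mass s"
        using cheeger_1_le[OF disj] beta_eq[OF disj(1)] s_eq by simp
      then show "?h * mass s \<le> variation s"
        using mass_pos[OF \<open>s \<noteq> 0\<close>] by (simp add: le_divide_eq)
    qed
    ultimately show "\<exists>f\<in>T. ?h \<le> variation f" using u by auto
  qed simp
qed

section \<open>The second eigenvalue\<close>

text \<open>
  If no \<open>f\<close> in \<open>S\<close> has median \<open>0\<close>, then for each \<open>f\<close> exactly one of the sets where \<open>\<tau> f\<close> is
  positive and where it is negative has more than half of the volume. Which one it is defines an odd
  function with values \<open>1\<close> and \<open>-1\<close>. It is continuous because both alternatives are open conditions
  on \<open>f\<close>: strict positivity on a given vertex set survives small perturbations.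
\<close>

lemma genus_ge_2_imp_zero_median:
  fixes \<tau> :: "'v \<Rightarrow> real" and S :: "(real ^ 'v) set"
  assumes "enat 2 \<le> genus S"
  obtains f where "f \<in> S" "2 * volume \<mu> {x. 0 < \<tau> x * f $ x} \<le> volume \<mu> UNIV"
    "2 * volume \<mu> {x. \<tau> x * f $ x < 0} \<le> volume \<mu> UNIV"
proof (rule ccontr)
  assume no_median: "\<not> thesis"
  let ?P = "\<lambda>f. {x. 0 < \<tau> x * f $ x}"
  have neg: "{x. \<tau> x * f $ x < 0} = ?P (- f)" for f :: "real ^ 'v" by auto
  define Pos where "Pos = {f :: real ^ 'v. volume \<mu> UNIV < 2 * volume \<mu> (?P f)}"
  have vol_mono: "volume \<mu> A \<le> volume \<mu> B" if "A \<subseteq> B" for A B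
    unfolding volume_def using that vertex_weight_pos by (intro sum_mono2) (auto simp: less_imp_le)
  \<comment> \<open>This form shows that the set is open: each \<open>A\<close> imposes finitely many strict inequalities.\<close>
  have "Pos = (\<Union>A\<in>{A. volume \<mu> UNIV < 2 * volume \<mu> A}. \<Inter>x\<in>A. {f. 0 < \<tau> x * f $ x})"
  proof (intro set_eqI iffI)
    fix f assume "f \<in> Pos"
    then show "f \<in> (\<Union>A\<in>{A. volume \<mu> UNIV < 2 * volume \<mu> A}. \<Inter>x\<in>A. {f. 0 < \<tau> x * f $ x})"
      unfolding Pos_def by blast
  next
    fix f assume "f \<in> (\<Union>A\<in>{A. volume \<mu> UNIV < 2 * volume \<mu> A}. \<Inter>x\<in>A. {f. 0 < \<tau> x * f $ x})"
    then obtain A where "volume \<mu> UNIV < 2 * volume \<mu> A" "A \<subseteq> ?P f" by auto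
    then show "f \<in> Pos" using vol_mono[of A "?P f"] by (simp add: Pos_def)
  qed
  moreover have "open {f :: real ^ 'v. 0 < \<tau> x * f $ x}" for x
    by (intro open_Collect_less continuous_intros)
  ultimately have "open Pos" by (auto intro!: open_INT)
  have "open (uminus ` Pos)" using \<open>open Pos\<close> by (rule open_negations)
  have cover: "S \<subseteq> Pos \<union> uminus ` Pos"
  proof
    fix f assume "f \<in> S"
    have "f \<in> Pos \<or> - f \<in> Pos"
    proof (rule ccontr)
      assume "\<not> (f \<in> Pos \<or> - f \<in> Pos)"
      then have "2 * volume \<mu> (?P f) \<le> volume \<mu> UNIV" "2 * volume \<mu> (?P (- f)) \<le> volume \<mu> UNIV"
        unfolding Pos_def mem_Collect_eq de_Morgan_disj not_less by blast+
      from that[OF \<open>f \<in> S\<close> this[folded neg]] show False using no_median by contradiction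
    qed
    then show "f \<in> Pos \<union> uminus ` Pos"
      using image_eqI[of f uminus "- f" Pos] by auto
  qed
  have disj: "- f \<notin> Pos" if "f \<in> Pos" for f
  proof -
    have "volume \<mu> (?P f) + volume \<mu> (?P (- f)) = volume \<mu> (?P f \<union> ?P (- f))"
      unfolding volume_def by (rule sum.union_disjoint[symmetric]) auto
    also have "\<dots> \<le> volume \<mu> UNIV" by (rule vol_mono) simp
    finally show ?thesis using that by (simp add: Pos_def)
  qed
  define \<phi> :: "real ^ 'v \<Rightarrow> real" where "\<phi> f = (if f \<in> Pos then 1 else -1)" for f
  have "continuous_on (Pos \<union> uminus ` Pos) \<phi>"
  proof (rule continuous_on_open_Un)
    show "continuous_on Pos \<phi>"
      by (rule continuous_on_eq[OF continuous_on_const[of _ 1]]) (simp add: \<phi>_def)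
    show "continuous_on (uminus ` Pos) \<phi>"
      by (rule continuous_on_eq[OF continuous_on_const[of _ "-1"]]) (use disj in \<open>auto simp: \<phi>_def\<close>)
  qed fact+
  then have "continuous_on S \<phi>" using cover by (rule continuous_on_subset)
  moreover have "\<phi> f \<noteq> 0 \<and> \<phi> (- f) = - \<phi> f" if "f \<in> S" for f
  proof -
    have "f \<in> Pos \<or> f \<notin> Pos \<and> - f \<in> Pos"
      using cover that disj[of f] by auto
    then show ?thesis using disj[of f] by (auto simp: \<phi>_def)
  qed
  ultimately show False using assms by (auto simp: genus_ge_2_iff)
qed

definition switched_indicator :: "('v \<Rightarrow> real) \<Rightarrow> 'v set \<Rightarrow> real ^ 'v" where
  "switched_indicator \<tau> A = (\<chi> x. \<tau> x * indicator A x)"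

context
  fixes \<tau> :: "'v \<Rightarrow> real"
  assumes switch_values: "\<tau> x \<in> {-1, 1}"
    and switch: "{x, y} \<in> E \<Longrightarrow> \<tau> x * \<sigma> {x, y} * \<tau> y = 1"
begin

lemma switched_difference:
  assumes "{x, y} \<in> E"
  shows "f $ x - \<sigma> {x, y} * f $ y = \<tau> x * (\<tau> x * f $ x - \<tau> y * f $ y)"
  using switch[OF assms] switch_values[of x] switch_values[of y] by (auto simp: algebra_simps)

text \<open>
  After switching, the variation of an indicator is the weight of the cut between the set and its
  complement.
\<close>

lemma variation_switched_indicator_Compl:
  "variation (switched_indicator \<tau> (- A)) = variation (switched_indicator \<tau> A)"
proof -
  have sq: "\<tau> z * (\<tau> z * c) = c" for z c using switch_values[of z] by auto
  have "edge_variation \<sigma> (switched_indicator \<tau> (- A)) e = edge_variation \<sigma> (switched_indicator \<tau> A) e"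
    if "e \<in> E" for e
    using that
  proof (rule edgeE)
    fix x y assume e: "e = {x, y}" and *: "\<And>f. edge_variation \<sigma> f e = \<bar>f $ x - \<sigma> e * f $ y\<bar>"
    have xy: "{x, y} \<in> E" using that e by simp
    show ?thesis
      unfolding * unfolding e switched_difference[OF xy] abs_mult
      by (simp add: switched_indicator_def sq indicator_def)
  qed
  then show ?thesis by (simp add: variation_def)
qed

lemma switched_indicator_eq_sign_vector:
  "switched_indicator \<tau> A = sign_vector {x \<in> A. \<tau> x = 1} {x \<in> A. \<tau> x = -1}"
proof -
  have "\<tau> x * indicator A x
      = (indicator {x \<in> A. \<tau> x = 1} x - indicator {x \<in> A. \<tau> x = -1} x :: real)" for x
    using switch_values[of x] by (auto simp: indicator_def)
  then show ?thesis by (simp add: switched_indicator_def sign_vector_def)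
qed

lemma mass_switched_indicator: "mass (switched_indicator \<tau> A) = volume \<mu> A"
proof -
  have "{x \<in> A. \<tau> x = 1} \<union> {x \<in> A. \<tau> x = -1} = A" using switch_values by auto
  then show ?thesis
    unfolding switched_indicator_eq_sign_vector by (subst mass_sign_vector) auto
qed

text \<open>
  The set and its complement, each split by the sign of \<open>\<tau>\<close>, compete in the definition of the
  second Cheeger constant. Both have the same variation, so the quotient of the smaller one
  is the maximum of the two.
\<close>

lemma cheeger_2_le_switched_indicator:
  assumes "A \<noteq> {}" "2 * volume \<mu> A \<le> volume \<mu> UNIV"
  shows "cheeger E w \<mu> \<sigma> 2 * volume \<mu> A \<le> variation (switched_indicator \<tau> A)"
proof -
  let ?p = "\<lambda>B. {x \<in> B. \<tau> x = 1}" and ?m = "\<lambda>B. {x \<in> B. \<tau> x = -1}"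
  let ?v = "variation (switched_indicator \<tau> A)"
  have Un: "?p B \<union> ?m B = B" and Int: "?p B \<inter> ?m B = {}" for B using switch_values by auto
  have pos: "0 < volume \<mu> A"
    unfolding volume_def using assms(1) vertex_weight_pos by (intro sum_pos) auto
  have "volume \<mu> UNIV = volume \<mu> A + volume \<mu> (- A)"
    unfolding volume_def by (subst sum.union_disjoint[symmetric]) auto
  then have le: "volume \<mu> A \<le> volume \<mu> (- A)" using assms(2) by simp
  then have "- A \<noteq> {}" using pos by (auto simp: volume_def)
  have beta: "beta E w \<mu> \<sigma> (?p B) (?m B) = variation (switched_indicator \<tau> B) / volume \<mu> B" for B
    unfolding beta_eq[OF Int] switched_indicator_eq_sign_vector[symmetric] mass_switched_indicator ..
  have v: "0 \<le> ?v"
    unfolding variation_def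
    by (intro sum_nonneg mult_nonneg_nonneg) (auto simp: edge_measure_pos less_imp_le elim!: edgeE)
  have "cheeger E w \<mu> \<sigma> 2 \<le> max (beta E w \<mu> \<sigma> (?p A) (?m A)) (beta E w \<mu> \<sigma> (?p (- A)) (?m (- A)))"
    using assms(1) \<open>- A \<noteq> {}\<close> by (intro cheeger_2_le) (unfold Un Int, auto)
  also have "\<dots> = max (?v / volume \<mu> A) (?v / volume \<mu> (- A))"
    unfolding beta variation_switched_indicator_Compl ..
  also have "\<dots> = ?v / volume \<mu> A"
    using pos le v by (intro max_absorb1 divide_left_mono) auto
  finally show ?thesis using pos by (simp add: le_divide_eq)
qed

text \<open>
  If \<open>\<tau> f\<close> is nonnegative, then the layers of \<open>f\<close> are switched indicators of subsets of its support,
  which inherit the volume bound.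
\<close>

lemma cheeger_2_le_one_sided:
  assumes f: "\<And>x. 0 \<le> \<tau> x * f $ x" and "2 * volume \<mu> {x. f $ x \<noteq> 0} \<le> volume \<mu> UNIV"
  shows "cheeger E w \<mu> \<sigma> 2 * mass f \<le> variation f"
proof (rule mass_le_variation_by_layers)
  fix s :: "real ^ 'v" assume "s \<noteq> 0" and s: "\<And>x. s $ x \<in> {0, sgn (f $ x)}"
  define A where "A = {x. s $ x \<noteq> 0}"
  have s_eq: "s = switched_indicator \<tau> A"
  proof -
    have "s $ x = \<tau> x * indicator A x" for x
      using s[of x] f[of x] switch_values[of x]
      by (auto simp: A_def indicator_def sgn_if split: if_splits)
    then show ?thesis by (simp add: vec_eq_iff switched_indicator_def)
  qed
  have "A \<subseteq> {x. f $ x \<noteq> 0}" using s by (force simp: A_def)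
  then have "volume \<mu> A \<le> volume \<mu> {x. f $ x \<noteq> 0}"
    unfolding volume_def using vertex_weight_pos by (intro sum_mono2) (auto simp: less_imp_le)
  moreover have "A \<noteq> {}" using \<open>s \<noteq> 0\<close> by (auto simp: A_def vec_eq_iff)
  ultimately have "cheeger E w \<mu> \<sigma> 2 * volume \<mu> A \<le> variation (switched_indicator \<tau> A)"
    using assms(2) by (intro cheeger_2_le_switched_indicator) auto
  then show "cheeger E w \<mu> \<sigma> 2 * mass s \<le> variation s"
    using s_eq mass_switched_indicator[of A] by simp
qed

text \<open>
  The positive part \<open>p\<close> and the negative part \<open>q\<close> (both multiplied by \<open>\<tau>\<close>) are one-sided. Variation
  is additive on \<open>f = p - q\<close>, because after switching it becomes the variation for the signature \<open>1\<close>,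
  and on each edge \<open>p\<close> and \<open>-q\<close> change in the same direction.
\<close>

lemma cheeger_2_le_zero_median:
  assumes "2 * volume \<mu> {x. 0 < \<tau> x * f $ x} \<le> volume \<mu> UNIV"
    and "2 * volume \<mu> {x. \<tau> x * f $ x < 0} \<le> volume \<mu> UNIV"
  shows "cheeger E w \<mu> \<sigma> 2 * mass f \<le> variation f"
proof -
  define p :: "real ^ 'v" where "p = (\<chi> x. if 0 < \<tau> x * f $ x then f $ x else 0)"
  define q :: "real ^ 'v" where "q = (\<chi> x. if \<tau> x * f $ x < 0 then - f $ x else 0)"
  have f: "f = p + (-1) *\<^sub>R q"
  proof -
    have "f $ x = p $ x + (-1) *\<^sub>R q $ x" for x
      using switch_values[of x] by (auto simp: p_def q_def)
    then show ?thesis by (simp add: vec_eq_iff)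
  qed
  have p: "0 \<le> \<tau> x * p $ x" and q: "0 \<le> \<tau> x * q $ x" and pq: "p $ x * q $ x = 0" for x
    by (auto simp: p_def q_def)
  have "{x. p $ x \<noteq> 0} = {x. 0 < \<tau> x * f $ x}" "{x. q $ x \<noteq> 0} = {x. \<tau> x * f $ x < 0}"
    by (auto simp: p_def q_def)
  then have "cheeger E w \<mu> \<sigma> 2 * mass p \<le> variation p" "cheeger E w \<mu> \<sigma> 2 * mass q \<le> variation q"
    using assms by (intro cheeger_2_le_one_sided; simp add: p q)+
  moreover have "mass f = mass p + mass q"
  proof -
    have "p $ x * ((-1) *\<^sub>R q) $ x = 0" for x using pq[of x] by simp
    then have "mass f = mass p + mass ((-1) *\<^sub>R q)"
      unfolding f by (intro mass_add) (simp only: order_refl)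
    then show ?thesis by (simp only: mass_scaleR)
  qed
  moreover have "variation f = variation p + variation q"
  proof -
    have "variation f = variation p + variation ((-1) *\<^sub>R q)"
      unfolding f
    proof (rule variation_add)
      fix x y assume e: "{x, y} \<in> E"
      define a b c d where "a = \<tau> x * p $ x" and "b = \<tau> y * p $ y"
        and "c = \<tau> x * q $ x" and "d = \<tau> y * q $ y"
      have products: "a * c = 0" "b * d = 0"
        using pq[of x] pq[of y] by (auto simp: a_def b_def c_def d_def)
      have expand: "(a - b) * (d - c) = a * d + b * c - (a * c + b * d)"
        by (simp add: algebra_simps)
      have "0 \<le> a" "0 \<le> b" "0 \<le> c" "0 \<le> d" using p q by (auto simp: a_def b_def c_def d_def)
      then have "0 \<le> (\<tau> x * \<tau> x) * ((a - b) * (d - c))"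
        unfolding expand products by simp
      then show "0 \<le> (p $ x - \<sigma> {x, y} * p $ y) *
          (((-1) *\<^sub>R q) $ x - \<sigma> {x, y} * ((-1) *\<^sub>R q) $ y)"
        unfolding switched_difference[OF e] by (simp add: a_def b_def c_def d_def algebra_simps)
    qed
    then show ?thesis by (simp add: variation_scaleR[of "-1" q, simplified])
  qed
  ultimately show ?thesis by (simp add: algebra_simps)
qed

end

lemma eigenvalue1_2_eq_cheeger:
  assumes "balanced E \<sigma>" "2 \<le> CARD('v)"
  shows "eigenvalue1 E w \<mu> \<sigma> 2 = cheeger E w \<mu> \<sigma> 2"
proof -
  let ?h = "cheeger E w \<mu> \<sigma> 2"
  obtain \<tau> where \<tau>: "\<And>x. \<tau> x \<in> {-1, 1::real}" "\<And>x y. {x, y} \<in> E \<Longrightarrow> \<tau> x * \<sigma> {x, y} * \<tau> y = 1"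
    using assms(1) by (auto simp: balanced_def)
  obtain a b :: 'v where "a \<noteq> b"
    using assms(2) by (metis One_nat_def Suc_1 card_le_Suc0_iff_eq finite_class.finite_UNIV not_less_eq_eq)
  then have "cheeger_family 2 (two_pairs {a} {} {b} {})"
    by (intro cheeger_family_2_two_pairs) auto
  then obtain U where U: "cheeger_family 2 U"
    "\<And>i. i \<in> {1..2} \<Longrightarrow> beta E w \<mu> \<sigma> (U (2 * i - 1)) (U (2 * i)) \<le> ?h"
    by (rule cheeger_attained) blast
  have two: "{1..2::nat} = {1, 2}" by auto
  have disj: "U 1 \<inter> U 2 = {}" "U 1 \<union> U 2 \<noteq> {}" "U 3 \<inter> U 4 = {}" "U 3 \<union> U 4 \<noteq> {}"
      "(U 1 \<union> U 2) \<inter> (U 3 \<union> U 4) = {}"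
    using U(1) unfolding cheeger_family_def two by (simp_all add: insert_commute)
  have le: "beta E w \<mu> \<sigma> (U 1) (U 2) \<le> ?h" "beta E w \<mu> \<sigma> (U 3) (U 4) \<le> ?h"
    using U(2)[of 1] U(2)[of 2] by simp_all
  let ?f = "sign_vector (U 1) (U 2)" and ?g = "sign_vector (U 3) (U 4)"
  have nz: "?f \<noteq> 0" "?g \<noteq> 0"
    by (rule sign_vector_nonzero[OF disj(1,2)], rule sign_vector_nonzero[OF disj(3,4)])
  have fg: "variation ?f \<le> ?h * mass ?f" "variation ?g \<le> ?h * mass ?g"
    by (rule variation_sign_vector_le[OF disj(1,2) le(1)],
        rule variation_sign_vector_le[OF disj(3,4) le(2)])
  have "?f $ x * ?g $ x = 0" for x
    using disj(5) by (auto simp: sign_vector_def indicator_def)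
  then obtain S where S: "S \<in> genus_family \<mu> 2"
    "\<And>u. u \<in> S \<Longrightarrow> \<exists>a b. u = a *\<^sub>R ?f + b *\<^sub>R ?g \<and> \<bar>a\<bar> * mass ?f + \<bar>b\<bar> * mass ?g = 1"
    using genus_family_2_circle[OF nz] by metis
  show ?thesis
  proof (rule eigenvalue1_eqI[OF _ S(1)])
    fix u assume "u \<in> S"
    then obtain a b where u: "u = a *\<^sub>R ?f + b *\<^sub>R ?g" and ab: "\<bar>a\<bar> * mass ?f + \<bar>b\<bar> * mass ?g = 1"
      using S(2) by blast
    have "variation u \<le> \<bar>a\<bar> * variation ?f + \<bar>b\<bar> * variation ?g"
      unfolding u using variation_triangle by (metis variation_scaleR)
    also have "\<dots> \<le> \<bar>a\<bar> * (?h * mass ?f) + \<bar>b\<bar> * (?h * mass ?g)"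
      using fg by (intro add_mono mult_left_mono) auto
    also have "\<dots> = ?h * (\<bar>a\<bar> * mass ?f + \<bar>b\<bar> * mass ?g)" by (simp add: algebra_simps)
    finally show "variation u \<le> ?h" using ab by simp
  next
    fix T assume T: "T \<in> genus_family \<mu> 2"
    then have "enat 2 \<le> genus T" by (simp add: genus_family_def)
    then obtain u where u: "u \<in> T" "2 * volume \<mu> {x. 0 < \<tau> x * u $ x} \<le> volume \<mu> UNIV"
      "2 * volume \<mu> {x. \<tau> x * u $ x < 0} \<le> volume \<mu> UNIV"
      by (rule genus_ge_2_imp_zero_median)
    have "mass u = 1" using u(1) T by (auto simp: genus_family_def unit_sphere1_iff)
    then have "?h \<le> variation u"
      using cheeger_2_le_zero_median[OF \<tau> u(2,3)] by simp
    then show "\<exists>f\<in>T. ?h \<le> variation f" using u(1) by blast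
  qed simp
qed

end

theorem corollary4p1:
  fixes E :: "'v::finite set set"
    and w :: "'v set \<Rightarrow> real"
    and \<mu> :: "'v \<Rightarrow> real"
    and \<sigma> :: "'v set \<Rightarrow> real"
  assumes "signed_graph E w \<mu> \<sigma>"
  shows "eigenvalue1 E w \<mu> \<sigma> 1 = cheeger E w \<mu> \<sigma> 1 \<and>
    (balanced E \<sigma> \<and> CARD('v) \<ge> 2 \<longrightarrow> eigenvalue1 E w \<mu> \<sigma> 2 = cheeger E w \<mu> \<sigma> 2)"
proof -
  interpret signed_graph E w \<mu> \<sigma> by fact
  show ?thesis
    using eigenvalue1_1_eq_cheeger eigenvalue1_2_eq_cheeger by blast
qed

end
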